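(* Let $\mathbf M$ be a balanced residuated partially ordered semigroup and let $\Omega$ be a $\tau$-residuation-coherent skeleton partition of $\operatorname{Sk}(\mathbf M)$. Let $A,B\in\Omega$, $x\in L_A$, $y\in L_B$, and put $C=A\vee B$ in the quotient skeleton of $\Omega$. Then $xy,\ x\backslash y,\ x/y\in L_C$. Consequently multiplication and both residuals are component-targeted by the quotient skeleton.
   Context: A residuated partially ordered semigroup is a structure $\mathbf M=\langle M,\le,\cdot,\backslash,/\rangle$ with $\langle M,\le\rangle$ a poset, $\langle M,\cdot\rangle$ a semigroup, and $xy\le z\iff x\le z/y\iff y\le x\backslash z$. An element $p\in M$ is positive if $z\le zp$ and $z\le pz$ for all $z\in M$. $\mathbf M$ is balanced if for every $x\in M$ one has $x\backslash x=x/x$ and this common value is positive; it is then automatically idempotent. Put $\tau(x):=x\backslash x=x/x$. The positive-idempotent skeleton $\operatorname{Sk}(\mathbf M)$ is the set of positive idempotents with the order inherited from $\mathbf M$; it is a join-semilattice in which $u\vee v=uv=vu$. For $A\subseteq S=\operatorname{Sk}(\mathbf M)$ put $L_A:=\{x\in M:\tau(x)\in A\}$. A skeleton partition is a partition of $S$. For $A,B\subseteq S$ put $A\star_\tau B:=\{\tau(xy),\tau(x\backslash y),\tau(x/y): x\in L_A,\ y\in L_B\}$. A skeleton partition $\Omega$ is $\tau$-residuation-coherent if for all $A,B\in\Omega$ exactly one block of $\Omega$ meets $A\star_\tau B$. The quotient skeleton of such an $\Omega$ is the join-semilattice $\Omega$ with the well-defined join $A\vee B:=$ the $\Omega$-block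 of $u\vee v$ (any $u\in A$, $v\in B$). "Component-targeted" means that the component $L_C$ containing the output is determined by the blocks of the inputs through $C=A\vee B$. *)

theory Defs
  imports "HOL-Library.Disjoint_Sets"
begin

class residuated_posemigroup = order + semigroup_mult +
  fixes left_residual :: "'a \<Rightarrow> 'a \<Rightarrow> 'a"  (infixl "\<setminus>" 70)
    and right_residual :: "'a \<Rightarrow> 'a \<Rightarrow> 'a"  (infixl "\<sslash>" 70)
  assumes right_residuation: "x * y \<le> z \<longleftrightarrow> x \<le> z \<sslash> y"
    and left_residuation: "x * y \<le> z \<longleftrightarrow> y \<le> x \<setminus> z"
begin

definition positive :: "'a \<Rightarrow> bool"
  where "positive p \<longleftrightarrow> (\<forall>z. z \<le> z * p \<and> z \<le> p * z)"

end

class balanced_residuated_posemigroup = residuated_posemigroup +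
  assumes self_residuals_eq: "x \<setminus> x = x \<sslash> x"
    and self_residual_positive: "positive (x \<setminus> x)"
begin

definition \<tau> :: "'a \<Rightarrow> 'a"
  where "\<tau> x = x \<setminus> x"

definition skeleton :: "'a set"
  where "skeleton = {p. positive p \<and> p * p = p}"

text \<open>The join is taken in the inherited order of the skeleton, not in the ambient order;
  that it exists is shown in \<open>skeleton_join_eq_mult\<close> below.\<close>

definition is_skeleton_join :: "'a \<Rightarrow> 'a \<Rightarrow> 'a \<Rightarrow> bool"
  where "is_skeleton_join u v w \<longleftrightarrow>
    w \<in> skeleton \<and> u \<le> w \<and> v \<le> w \<and> (\<forall>s\<in>skeleton. u \<le> s \<and> v \<le> s \<longrightarrow> w \<le> s)"

definition skeleton_join :: "'a \<Rightarrow> 'a \<Rightarrow> 'a"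
  where "skeleton_join u v = (THE w. is_skeleton_join u v w)"

definition component :: "'a set \<Rightarrow> 'a set"
  where "component A = {x. \<tau> x \<in> A}"

definition tau_star :: "'a set \<Rightarrow> 'a set \<Rightarrow> 'a set"  (infixl "\<star>" 75)
  where "A \<star> B = (\<Union>x\<in>component A. \<Union>y\<in>component B. {\<tau> (x * y), \<tau> (x \<setminus> y), \<tau> (x \<sslash> y)})"

definition skeleton_partition :: "'a set set \<Rightarrow> bool"
  where "skeleton_partition \<Omega> \<longleftrightarrow> partition_on skeleton \<Omega>"

definition tau_residuation_coherent :: "'a set set \<Rightarrow> bool"
  where "tau_residuation_coherent \<Omega> \<longleftrightarrow>
    (\<forall>A\<in>\<Omega>. \<forall>B\<in>\<Omega>. \<exists>!C. C \<in> \<Omega> \<and> C \<inter> (A \<star> B) \<noteq> {})"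

text \<open>The join of the quotient skeleton; it is only meaningful for residuation-coherent skeleton
  partitions; see \<open>quotient_join_well_defined\<close> below.\<close>

definition quotient_join :: "'a set set \<Rightarrow> 'a set \<Rightarrow> 'a set \<Rightarrow> 'a set"
  where "quotient_join \<Omega> A B = (THE C. C \<in> \<Omega> \<and> (\<forall>u\<in>A. \<forall>v\<in>B. skeleton_join u v \<in> C))"

definition component_targeted :: "'a set set \<Rightarrow> ('a \<Rightarrow> 'a \<Rightarrow> 'a) \<Rightarrow> bool"
  where "component_targeted \<Omega> f \<longleftrightarrow>
    (\<forall>A\<in>\<Omega>. \<forall>B\<in>\<Omega>. quotient_join \<Omega> A B \<in> \<Omega> \<and>
      (\<forall>x\<in>component A. \<forall>y\<in>component B. \<forall>C\<in>\<Omega>.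
        f x y \<in> component C \<longleftrightarrow> C = quotient_join \<Omega> A B))"

lemma residual_mult_le: "x * (x \<setminus> z) \<le> z" "(z \<sslash> x) * x \<le> z"
  using left_residuation right_residuation by blast+

lemma mult_mono': "a \<le> b \<Longrightarrow> c \<le> d \<Longrightarrow> a * c \<le> b * d"
  by (meson left_residuation order.trans order_refl right_residuation)

lemma tau_in_skeleton: "\<tau> x \<in> skeleton"
proof -
  have "x * (\<tau> x * \<tau> x) \<le> x"
    by (metis \<tau>_def left_residuation mult.assoc mult_mono' order.trans order_refl)
  then have "\<tau> x * \<tau> x \<le> \<tau> x"
    by (simp add: \<tau>_def left_residuation)
  moreover have "\<tau> x \<le> \<tau> x * \<tau> x"
    using self_residual_positive by (simp add: \<tau>_def positive_def)
  ultimately show ?thesis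
    using self_residual_positive by (simp add: skeleton_def \<tau>_def order.antisym)
qed

lemma tau_skeleton: "u \<in> skeleton \<Longrightarrow> \<tau> u = u"
  by (metis (mono_tags, lifting) \<tau>_def left_residuation mem_Collect_eq order.antisym order.refl
      order.trans positive_def residual_mult_le(1) skeleton_def)

lemma skeleton_mult_closed:
  assumes "u \<in> skeleton" "v \<in> skeleton"
  shows "u * v \<in> skeleton"
proof -
  let ?w = "\<tau> (u * v)"
  have w: "positive ?w" "?w * ?w = ?w"
    using tau_in_skeleton by (auto simp: skeleton_def)
  have u: "u \<le> ?w"
    using assms(1)
    by (metis (mono_tags, lifting) \<tau>_def mem_Collect_eq mult.assoc order.refl right_residuation
        self_residuals_eq skeleton_def)
  have v: "v \<le> ?w"
    using assms(2)
    by (metis (mono_tags, lifting) \<tau>_def left_residuation mem_Collect_eq mult.assoc order.refl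
        skeleton_def)
  have "u * v \<le> ?w"
    using mult_mono'[OF u v] w(2) by simp
  moreover have "?w \<le> (u * v) * ?w"
  proof -
    have "?w \<le> v * ?w" "v * ?w \<le> u * (v * ?w)"
      using assms by (auto simp: skeleton_def positive_def)
    then show ?thesis by (simp add: mult.assoc)
  qed
  moreover have "(u * v) * ?w \<le> u * v"
    using residual_mult_le(1) by (simp add: \<tau>_def)
  ultimately have "?w = u * v" by (meson order.antisym order.trans)
  then show ?thesis using tau_in_skeleton by metis
qed

lemma skeleton_join_eq_mult:
  assumes "u \<in> skeleton" "v \<in> skeleton"
  shows "is_skeleton_join u v (u * v)" and "skeleton_join u v = u * v"
proof -
  show *: "is_skeleton_join u v (u * v)"
    unfolding is_skeleton_join_def
  proof (intro conjI ballI impI)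
    show "u * v \<in> skeleton" using skeleton_mult_closed assms .
    show "u \<le> u * v" "v \<le> u * v"
      using assms by (auto simp: skeleton_def positive_def)
    show "u * v \<le> s" if "s \<in> skeleton" "u \<le> s \<and> v \<le> s" for s
      using that mult_mono'[of u s v s] by (auto simp: skeleton_def)
  qed
  show "skeleton_join u v = u * v"
    unfolding skeleton_join_def
  proof (rule the_equality)
    show "is_skeleton_join u v (u * v)" by (rule *)
  next
    show "w = u * v" if "is_skeleton_join u v w" for w
      using that * unfolding is_skeleton_join_def by (auto intro: order.antisym)
  qed
qed

lemma quotient_join_well_defined:
  assumes "skeleton_partition \<Omega>" "tau_residuation_coherent \<Omega>" "A \<in> \<Omega>" "B \<in> \<Omega>"
  shows "\<exists>!C. C \<in> \<Omega> \<and> (\<forall>u\<in>A. \<forall>v\<in>B. skeleton_join u v \<in> C)"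
proof -
  have P: "\<Union>\<Omega> = skeleton" "disjoint \<Omega>" "{} \<notin> \<Omega>"
    using assms(1) by (auto simp: skeleton_partition_def partition_on_def)
  obtain C where C: "C \<in> \<Omega>" "\<And>D. D \<in> \<Omega> \<Longrightarrow> D \<inter> (A \<star> B) \<noteq> {} \<Longrightarrow> D = C"
    using assms(2-4) unfolding tau_residuation_coherent_def by metis
  have C': "skeleton_join u v \<in> C" if "u \<in> A" "v \<in> B" for u v
  proof -
    have uv: "u \<in> skeleton" "v \<in> skeleton" using that assms(3,4) P(1) by auto
    then obtain D where D: "D \<in> \<Omega>" "u * v \<in> D"
      using skeleton_mult_closed P(1) by blast
    have "\<tau> (u * v) \<in> A \<star> B"
      using that tau_skeleton[OF uv(1)] tau_skeleton[OF uv(2)]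
      by (force simp: tau_star_def component_def)
    then have "D \<inter> (A \<star> B) \<noteq> {}"
      using D(2) tau_skeleton skeleton_mult_closed uv by auto
    then show ?thesis using C(2) D uv skeleton_join_eq_mult(2) by auto
  qed
  obtain u v where uv: "u \<in> A" "v \<in> B" using assms(3,4) P(3) by (metis ex_in_conv)
  have "D = C" if "D \<in> \<Omega>" "skeleton_join u v \<in> D" for D
    using that C(1) C'[OF uv] P(2) disjointD by (metis IntI empty_iff)
  then show ?thesis
    using C(1) C' uv by blast
qed

end

end

theory Submission
  imports Defs
begin

text \<open>For representatives \<open>u \<in> A\<close> and \<open>v \<in> B\<close>, the element \<open>\<tau> (u * v) = u * v\<close> lies both in
  \<open>A \<star> B\<close> and in the quotient join of \<open>A\<close> and \<open>B\<close>. So the only block that meets \<open>A \<star> B\<close> is the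
  quotient join, and since the blocks cover the skeleton, it contains all of \<open>A \<star> B\<close>.\<close>

context balanced_residuated_posemigroup
begin

lemma tau_star_subset_skeleton: "A \<star> B \<subseteq> skeleton"
  using tau_in_skeleton by (auto simp: tau_star_def)

lemma tau_in_tau_star:
  assumes "x \<in> component A" "y \<in> component B"
  shows "\<tau> (x * y) \<in> A \<star> B" "\<tau> (x \<setminus> y) \<in> A \<star> B" "\<tau> (x \<sslash> y) \<in> A \<star> B"
  using assms by (auto simp: tau_star_def)

text \<open>Since \<open>\<tau>\<close> fixes every positive idempotent, \<open>u\<close> and
  \<open>v\<close> themselves lie in the components of \<open>A\<close> and \<open>B\<close>. Their
  product is again fixed by \<open>\<tau>\<close> and is their join.\<close>

lemma skeleton_join_in_tau_star:
  assumes "u \<in> A" "v \<in> B" "u \<in> skeleton" "v \<in> skeleton"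
  shows "skeleton_join u v \<in> A \<star> B"
proof -
  have "u \<in> component A" "v \<in> component B"
    using assms by (auto simp: component_def tau_skeleton)
  then have "\<tau> (u * v) \<in> A \<star> B"
    by (rule tau_in_tau_star)
  then show ?thesis
    using assms(3,4) by (simp add: tau_skeleton skeleton_mult_closed skeleton_join_eq_mult)
qed

text \<open>Coherence makes the definite description behind \<open>quotient_join\<close> well
  defined, so its result inherits the defining property.\<close>

lemma quotient_join_closed:
  assumes "skeleton_partition \<Omega>" "tau_residuation_coherent \<Omega>" "A \<in> \<Omega>" "B \<in> \<Omega>"
  shows "quotient_join \<Omega> A B \<in> \<Omega>"
  using theI'[OF quotient_join_well_defined[OF assms]] by (simp add: quotient_join_def)

lemma skeleton_join_in_quotient_join:
  assumes "skeleton_partition \<Omega>" "tau_residuation_coherent \<Omega>" "A \<in> \<Omega>" "B \<in> \<Omega>"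
    and "u \<in> A" "v \<in> B"
  shows "skeleton_join u v \<in> quotient_join \<Omega> A B"
  using theI'[OF quotient_join_well_defined[OF assms(1-4)]] assms(5,6)
  by (simp add: quotient_join_def)

lemma tau_star_subset_quotient_join:
  assumes "skeleton_partition \<Omega>" "tau_residuation_coherent \<Omega>" "A \<in> \<Omega>" "B \<in> \<Omega>"
  shows "A \<star> B \<subseteq> quotient_join \<Omega> A B"
proof
  fix w assume w: "w \<in> A \<star> B"
  have P: "\<Union>\<Omega> = skeleton" "{} \<notin> \<Omega>"
    using assms(1) by (auto simp: skeleton_partition_def partition_on_def)
  \<comment> \<open>Blocks are nonempty, which supplies representatives; their join witnesses that
    the quotient join meets \<open>A \<star> B\<close>.\<close>
  obtain u v where uv: "u \<in> A" "v \<in> B"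
    using assms(3,4) P(2) by (metis ex_in_conv)
  have "u \<in> skeleton" "v \<in> skeleton"
    using uv assms(3,4) P(1) by auto
  then have join: "quotient_join \<Omega> A B \<inter> (A \<star> B) \<noteq> {}"
    using skeleton_join_in_tau_star[OF uv] skeleton_join_in_quotient_join[OF assms uv] by blast
  \<comment> \<open>The block \<open>D\<close> of \<open>w\<close> meets \<open>A \<star> B\<close>
    in \<open>w\<close> itself, so coherence identifies it with the quotient join.\<close>
  obtain D where D: "D \<in> \<Omega>" "w \<in> D"
    using w tau_star_subset_skeleton P(1) by blast
  have "\<exists>!C. C \<in> \<Omega> \<and> C \<inter> (A \<star> B) \<noteq> {}"
    using assms(2-4) by (simp add: tau_residuation_coherent_def)
  moreover have "D \<inter> (A \<star> B) \<noteq> {}"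
    using D(2) w by (metis IntI empty_iff)
  ultimately have "D = quotient_join \<Omega> A B"
    using D(1) join quotient_join_closed[OF assms] by metis
  then show "w \<in> quotient_join \<Omega> A B"
    using D(2) by simp
qed

text \<open>Only one direction of the equivalence in \<open>component_targeted\<close> depends on
  \<open>f\<close>; the other follows from disjointness of the components.\<close>

lemma component_targetedI:
  assumes "skeleton_partition \<Omega>" "tau_residuation_coherent \<Omega>"
    and f: "\<And>A B x y. A \<in> \<Omega> \<Longrightarrow> B \<in> \<Omega> \<Longrightarrow> x \<in> component A \<Longrightarrow> y \<in> component B \<Longrightarrow>
      f x y \<in> component (quotient_join \<Omega> A B)"
  shows "component_targeted \<Omega> f"
proof -
  \<comment> \<open>A common element \<open>z\<close> puts \<open>\<tau> z\<close> into both
    blocks.\<close>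
  have unique: "C = D" if "C \<in> \<Omega>" "D \<in> \<Omega>" "z \<in> component C" "z \<in> component D" for C D z
  proof -
    have "disjoint \<Omega>"
      using assms(1) by (simp add: skeleton_partition_def partition_on_def)
    then show ?thesis
      using disjointD[of \<Omega> C D] that by (auto simp: component_def)
  qed
  show ?thesis
    unfolding component_targeted_def
  proof (intro ballI conjI iffI)
    fix A B assume AB: "A \<in> \<Omega>" "B \<in> \<Omega>"
    show join: "quotient_join \<Omega> A B \<in> \<Omega>"
      by (rule quotient_join_closed[OF assms(1,2) AB])
    fix x y C
    assume xy: "x \<in> component A" "y \<in> component B" and C: "C \<in> \<Omega>"
    show "C = quotient_join \<Omega> A B" if "f x y \<in> component C"
      by (rule unique[OF C join that f[OF AB xy]])
    show "f x y \<in> component C" if "C = quotient_join \<Omega> A B"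
      unfolding that by (rule f[OF AB xy])
  qed
qed

end

theorem proposition5p4:
  fixes \<Omega> :: "'a::balanced_residuated_posemigroup set set"
  assumes "skeleton_partition \<Omega>"
    and "tau_residuation_coherent \<Omega>"
  shows "(\<forall>A\<in>\<Omega>. \<forall>B\<in>\<Omega>. \<forall>x\<in>component A. \<forall>y\<in>component B.
      let C = quotient_join \<Omega> A B
      in x * y \<in> component C \<and> x \<setminus> y \<in> component C \<and> x \<sslash> y \<in> component C)
    \<and> component_targeted \<Omega> (*)
    \<and> component_targeted \<Omega> (\<setminus>)
    \<and> component_targeted \<Omega> (\<sslash>)"
proof -
  \<comment> \<open>Membership in a component is a condition on \<open>\<tau>\<close> alone, so one
    inclusion settles all three operations.\<close>
  have targets: "x * y \<in> component (quotient_join \<Omega> A B)"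
    "x \<setminus> y \<in> component (quotient_join \<Omega> A B)" "x \<sslash> y \<in> component (quotient_join \<Omega> A B)"
    if "A \<in> \<Omega>" "B \<in> \<Omega>" "x \<in> component A" "y \<in> component B" for A B x y
    using tau_in_tau_star[OF that(3,4)] tau_star_subset_quotient_join[OF assms that(1,2)]
    by (auto simp: component_def)
  then show ?thesis
    by (simp add: Let_def component_targetedI[OF assms])
qed

end
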